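(* Let $r\colon\mathbb{N}\to\mathbb{R}_0^+$ be a non-decreasing function, and let $r'\colon\mathbb{N}\to\mathbb{R}_0^+$ be defined by $r'(a)=r(a+1)$ for every $a\in\mathbb{N}$. Let $f$ be a graph parameter whose value is at most $r(1)$ on the empty graph. A class $\mathcal{G}$ of graphs is fractionally $f$-fragile at rate $r$ if and only if it is fractionally $f$-colorable by $1$ color at rate $r'$.
   Context: All graphs are finite. A graph parameter is a function assigning to every graph a non-negative real number such that isomorphic graphs get the same value. For $\varepsilon>0$, a probability distribution on subsets of $V(G)$ is $\varepsilon$-thin if for each vertex $v$, the probability that $v$ belongs to a set sampled from the distribution is at most $\varepsilon$. A graph $G$ is fractionally $f$-fragile at rate $r$ if for every positive integer $a$ there exists a $(1/a)$-thin probability distribution on the collection of sets $Y\subseteq V(G)$ satisfying $f(G-Y)\le r(a)$. A class of graphs is fractionally $f$-fragile at rate $r$ if every graph in the class is. For a real number $b$, let $\mathcal{M}_b(G)$ be the set of all $X\subseteq V(G)$ with $f(G[X])\le b$. A fractional $(f,b)$-coloring of $G$ is a function $\kappa\colon\mathcal{M}_b(G)\to[0,1]$ such that $\sum_{Y\in\mathcal{M}_b(G),\,v\in Y}\kappa(Y)\ge 1$ for each $v\in V(G)$; its number of colors is $|\kappa|=\sum_{Y\in\mathcal{M}_b(G)}\kappa(Y)$. Let $\chi'_{f,b}(G)$ be the infimum of $|\kappa|$ over all fractional $(f,b)$-colorings $\kappa$ of $G$. For a real number $c$ and a function $r\colon\mathbb{N}\to\mathbb{R}_0^+$, a class $\mathcal{G}$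 is fractionally $f$-colorable by $c$ colors at rate $r$ if for every integer $a\ge 1$, every graph $G\in\mathcal{G}$ satisfies $\chi'_{f,r(a)}(G)\le c+1/a$. *)

theory Defs
  imports "HOL-Probability.Probability" "Graph_Theory.Digraph_Isomorphism"
begin

text \<open>
  Finite simple graphs are represented by the locale predicate \<open>graph\<close> of the AFP entry
  Graph_Theory: finite symmetric digraphs without loops and parallel arcs, so that an undirected
  edge is a pair of opposite arcs. Values of \<open>tail\<close> and \<open>head\<close> outside the arc set are irrelevant
  up to \<open>digraph_iso\<close>; in particular all graphs without vertices are isomorphic.
\<close>

definition graph_parameter :: "(('a, 'b) pre_digraph \<Rightarrow> real) \<Rightarrow> bool" where
  "graph_parameter f \<longleftrightarrow>
     (\<forall>G. graph G \<longrightarrow> 0 \<le> f G) \<and>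
     (\<forall>G H. graph G \<longrightarrow> graph H \<longrightarrow> digraph_iso G H \<longrightarrow> f G = f H)"

definition remove_verts :: "('a, 'b) pre_digraph \<Rightarrow> 'a set \<Rightarrow> ('a, 'b) pre_digraph" where
  "remove_verts G Y = G \<restriction> (verts G - Y)"

definition thin :: "real \<Rightarrow> ('a, 'b) pre_digraph \<Rightarrow> 'a set pmf \<Rightarrow> bool" where
  "thin \<epsilon> G p \<longleftrightarrow>
     set_pmf p \<subseteq> Pow (verts G) \<and>
     (\<forall>v \<in> verts G. measure_pmf.prob p {Y. v \<in> Y} \<le> \<epsilon>)"

definition fractionally_fragile_graph ::
  "(('a, 'b) pre_digraph \<Rightarrow> real) \<Rightarrow> (nat \<Rightarrow> real) \<Rightarrow> ('a, 'b) pre_digraph \<Rightarrow> bool" where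
  "fractionally_fragile_graph f r G \<longleftrightarrow>
     (\<forall>a::nat. 1 \<le> a \<longrightarrow>
       (\<exists>p. set_pmf p \<subseteq> {Y. Y \<subseteq> verts G \<and> f (remove_verts G Y) \<le> r a} \<and>
            thin (1 / real a) G p))"

definition fractionally_fragile ::
  "(('a, 'b) pre_digraph \<Rightarrow> real) \<Rightarrow> (nat \<Rightarrow> real) \<Rightarrow> ('a, 'b) pre_digraph set \<Rightarrow> bool" where
  "fractionally_fragile f r \<G> \<longleftrightarrow> (\<forall>G \<in> \<G>. fractionally_fragile_graph f r G)"

definition bounded_subsets ::
  "(('a, 'b) pre_digraph \<Rightarrow> real) \<Rightarrow> real \<Rightarrow> ('a, 'b) pre_digraph \<Rightarrow> 'a set set" where
  "bounded_subsets f b G = {X. X \<subseteq> verts G \<and> f (G \<restriction> X) \<le> b}"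

definition fractional_coloring ::
  "(('a, 'b) pre_digraph \<Rightarrow> real) \<Rightarrow> real \<Rightarrow> ('a, 'b) pre_digraph \<Rightarrow> ('a set \<Rightarrow> real) \<Rightarrow> bool" where
  "fractional_coloring f b G \<kappa> \<longleftrightarrow>
     (\<forall>Y \<in> bounded_subsets f b G. \<kappa> Y \<in> {0..1}) \<and>
     (\<forall>v \<in> verts G. (\<Sum>Y \<in> {Y \<in> bounded_subsets f b G. v \<in> Y}. \<kappa> Y) \<ge> 1)"

definition number_of_colors ::
  "(('a, 'b) pre_digraph \<Rightarrow> real) \<Rightarrow> real \<Rightarrow> ('a, 'b) pre_digraph \<Rightarrow> ('a set \<Rightarrow> real) \<Rightarrow> real" where
  "number_of_colors f b G \<kappa> = (\<Sum>Y \<in> bounded_subsets f b G. \<kappa> Y)"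

text \<open>
  The infimum is taken in the extended reals, so that it is \<open>\<infinity>\<close> when no fractional coloring
  exists.
\<close>

definition fractional_chromatic_number ::
  "(('a, 'b) pre_digraph \<Rightarrow> real) \<Rightarrow> real \<Rightarrow> ('a, 'b) pre_digraph \<Rightarrow> ereal" where
  "fractional_chromatic_number f b G =
     (INF \<kappa> \<in> {\<kappa>. fractional_coloring f b G \<kappa>}. ereal (number_of_colors f b G \<kappa>))"

definition fractionally_colorable ::
  "(('a, 'b) pre_digraph \<Rightarrow> real) \<Rightarrow> real \<Rightarrow> (nat \<Rightarrow> real) \<Rightarrow> ('a, 'b) pre_digraph set \<Rightarrow> bool" where
  "fractionally_colorable f c r \<G> \<longleftrightarrow>
     (\<forall>a::nat. 1 \<le> a \<longrightarrow>
       (\<forall>G \<in> \<G>. fractional_chromatic_number f (r a) G \<le> ereal (c + 1 / real a)))"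

end

theory Submission
  imports Defs
begin

text \<open>
  A random \<open>Y\<close> and its complement \<open>X\<close> exchange the two notions: a distribution avoiding every
  vertex with probability at least \<open>a/(a + 1)\<close> becomes, after scaling by \<open>(a + 1)/a\<close>, a fractional
  coloring with \<open>1 + 1/a\<close> colors, and normalizing such a coloring gives the distribution back.
  The converse needs the infimum defining \<open>fractional_chromatic_number\<close> to be attained, which
  follows from compactness of the set of fractional colorings. Fragility at \<open>a = 1\<close> is not
  covered by the colorings; there one deletes all vertices.
\<close>

lemma finite_bounded_subsets:
  "finite (verts G) \<Longrightarrow> finite (bounded_subsets f b G)"
  unfolding bounded_subsets_def by (rule finite_subset[of _ "Pow (verts G)"]) auto

lemma graph_induce_empty:
  fixes G :: "('a, 'b) pre_digraph"
  shows "graph (G \<restriction> {})"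
  by unfold_locales (auto simp: symmetric_def arcs_ends_def sym_def)

lemma pmf_of_finite_weights:
  fixes w :: "'a \<Rightarrow> real"
  assumes "finite M" "\<And>x. x \<in> M \<Longrightarrow> 0 \<le> w x" "(\<Sum>x\<in>M. w x) = 1"
  obtains q where "set_pmf q \<subseteq> M" "\<And>x. x \<in> M \<Longrightarrow> pmf q x = w x"
proof
  let ?f = "\<lambda>x. if x \<in> M then w x else 0"
  have "(\<integral>\<^sup>+x. ennreal (?f x) \<partial>count_space UNIV) = (\<Sum>x\<in>M. ennreal (?f x))"
    using assms(1) by (intro nn_integral_count_space') auto
  also have "\<dots> = 1"
    using assms by (subst sum_ennreal) auto
  finally have pmf: "pmf (embed_pmf ?f) x = ?f x" for x
    using assms(2) by (intro pmf_embed_pmf) auto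
  then show "set_pmf (embed_pmf ?f) \<subseteq> M"
    by (auto simp: set_pmf_eq split: if_splits)
  show "pmf (embed_pmf ?f) x = w x" if "x \<in> M" for x
    using that by (simp add: pmf)
qed

text \<open>A continuous function on a nonempty compact set attains its minimum. The values of a
  coloring outside \<open>bounded_subsets f b G\<close> are unconstrained, so compactness is
  available only after fixing them.\<close>

lemma fractional_chromatic_number_attained:
  fixes G :: "('a, 'b) pre_digraph"
  assumes less: "fractional_chromatic_number f b G < \<infinity>"
  obtains \<kappa> where "fractional_coloring f b G \<kappa>"
    "ereal (number_of_colors f b G \<kappa>) = fractional_chromatic_number f b G"
proof -
  define M where "M = bounded_subsets f b G"
  define N where "N \<kappa> = number_of_colors f b G \<kappa>" for \<kappa>
  \<comment> \<open>Pinning the irrelevant coordinates to 0 makes \<open>K\<close> a product of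
    compact sets, hence compact by Tychonoff; the covering conditions collected in \<open>C\<close>
    are closed.\<close>
  define K where "K = (\<Pi>\<^sub>E Y\<in>UNIV. if Y \<in> M then {0..1::real} else {0})"
  define C where "C = (\<Inter>v\<in>verts G. {\<kappa>. (1::real) \<le> (\<Sum>Y\<in>{Y \<in> M. v \<in> Y}. \<kappa> Y)})"
  have cont: "continuous_on UNIV (\<lambda>\<kappa>. \<Sum>Y\<in>A. \<kappa> Y :: real)" for A :: "'a set set"
    by (intro continuous_on_sum continuous_on_product_coordinates)
  have "compact K"
  proof -
    have "compactin (product_topology (\<lambda>_. euclidean) UNIV) K"
      unfolding K_def by (subst compactin_PiE) auto
    then show ?thesis by (simp add: euclidean_product_topology)
  qed
  moreover have "closed C"
    unfolding C_def by (intro closed_INT ballI closed_Collect_le cont continuous_intros)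
  ultimately have compact: "compact (K \<inter> C)" by (rule compact_Int_closed)
  have KC: "fractional_coloring f b G \<kappa>" if "\<kappa> \<in> K \<inter> C" for \<kappa>
    using that unfolding fractional_coloring_def K_def C_def M_def
    by (auto simp: PiE_iff split: if_splits)
  \<comment> \<open>Setting a coloring to 0 outside \<open>M\<close> changes neither its covering
    sums nor its number of colors, so minimizing over \<open>K \<inter> C\<close> minimizes over all
    colorings.\<close>
  have trunc: "\<exists>\<mu>\<in>K \<inter> C. N \<mu> = N \<kappa>" if "fractional_coloring f b G \<kappa>" for \<kappa>
  proof
    let ?\<mu> = "\<lambda>Y. if Y \<in> M then \<kappa> Y else 0"
    show "N ?\<mu> = N \<kappa>"
      unfolding N_def number_of_colors_def M_def by (intro sum.cong) auto
    have "(\<Sum>Y\<in>{Y \<in> M. v \<in> Y}. ?\<mu> Y) = (\<Sum>Y\<in>{Y \<in> M. v \<in> Y}. \<kappa> Y)" for v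
      by (intro sum.cong) auto
    then show "?\<mu> \<in> K \<inter> C"
      using that unfolding fractional_coloring_def K_def C_def M_def by (auto simp: PiE_iff)
  qed
  \<comment> \<open>Here \<open>less\<close> enters: an empty infimum in \<open>ereal\<close> would
    be infinite.\<close>
  have "{\<kappa>. fractional_coloring f b G \<kappa>} \<noteq> {}"
  proof
    assume "{\<kappa>. fractional_coloring f b G \<kappa>} = {}"
    then have "fractional_chromatic_number f b G = \<infinity>"
      unfolding fractional_chromatic_number_def by (simp only: image_empty Inf_empty top_ereal_def)
    with less show False by simp
  qed
  then have "K \<inter> C \<noteq> {}" using trunc by blast
  moreover have "continuous_on (K \<inter> C) N"
    unfolding N_def number_of_colors_def by (rule continuous_on_subset[OF cont]) auto
  ultimately obtain \<kappa> where \<kappa>: "\<kappa> \<in> K \<inter> C" "\<And>\<mu>. \<mu> \<in> K \<inter> C \<Longrightarrow> N \<kappa> \<le> N \<mu>"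
    using continuous_attains_inf[OF compact] by blast
  have "N \<kappa> \<le> N \<mu>" if "fractional_coloring f b G \<mu>" for \<mu>
    using trunc[OF that] \<kappa>(2) by force
  then have "ereal (N \<kappa>) = fractional_chromatic_number f b G"
    unfolding fractional_chromatic_number_def N_def
    using KC[OF \<kappa>(1)] by (intro antisym INF_greatest INF_lower) auto
  with KC[OF \<kappa>(1)] that show thesis by (simp add: N_def)
qed

text \<open>The complement of a sampled set contains each vertex with probability at least
  \<open>1 - \<epsilon>\<close>. Dividing its probabilities by \<open>1 - \<epsilon>\<close> covers
  every vertex and makes the total weight \<open>1 / (1 - \<epsilon>)\<close>.\<close>

lemma fractional_chromatic_number_le_of_thin:
  fixes G :: "('a, 'b) pre_digraph"
  assumes fin: "finite (verts G)" and "\<epsilon> < 1"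
    and supp: "set_pmf p \<subseteq> {Y. Y \<subseteq> verts G \<and> f (remove_verts G Y) \<le> b}"
    and thin: "thin \<epsilon> G p"
  shows "fractional_chromatic_number f b G \<le> ereal (1 / (1 - \<epsilon>))"
proof -
  define M where "M = bounded_subsets f b G"
  define q where "q = map_pmf (\<lambda>Y. verts G - Y) p"
  \<comment> \<open>A scaled probability may exceed 1, while a coloring takes values in [0,1]. The
    cap can only lower the total.\<close>
  define \<kappa> where "\<kappa> X = min 1 (pmf q X / (1 - \<epsilon>))" for X
  have finM: "finite M" unfolding M_def using fin by (rule finite_bounded_subsets)
  have qM: "set_pmf q \<subseteq> M"
    using supp unfolding q_def M_def bounded_subsets_def remove_verts_def by auto
  have cover: "1 \<le> (\<Sum>X\<in>{X \<in> M. v \<in> X}. \<kappa> X)" if v: "v \<in> verts G" for v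
  \<comment> \<open>If the cap is active on some set containing \<open>v\<close>, that set alone
    covers \<open>v\<close>; otherwise the sum at \<open>v\<close> is exactly the scaled
    probability.\<close>
  proof (cases "\<exists>X\<in>{X \<in> M. v \<in> X}. 1 < pmf q X / (1 - \<epsilon>)")
    case True
    then obtain X where X: "X \<in> {X \<in> M. v \<in> X}" and "\<kappa> X = 1" by (auto simp: \<kappa>_def)
    then show ?thesis
      using member_le_sum[of X "{X \<in> M. v \<in> X}" \<kappa>] finM \<open>\<epsilon> < 1\<close> by (auto simp: \<kappa>_def)
  next
    case False
    then have "(\<Sum>X\<in>{X \<in> M. v \<in> X}. \<kappa> X) = (\<Sum>X\<in>{X \<in> M. v \<in> X}. pmf q X) / (1 - \<epsilon>)"
      unfolding sum_divide_distrib by (intro sum.cong) (auto simp: \<kappa>_def not_less min_def)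
    also have "(\<Sum>X\<in>{X \<in> M. v \<in> X}. pmf q X) = measure_pmf.prob q {X \<in> M. v \<in> X}"
      using finM by (simp add: measure_measure_pmf_finite)
    also have "\<dots> = measure_pmf.prob q {X. v \<in> X}"
      using qM by (intro measure_pmf.finite_measure_eq_AE) (auto simp: AE_measure_pmf_iff)
    also have "\<dots> = measure_pmf.prob p (UNIV - {Y. v \<in> Y})"
      using v unfolding q_def by (auto intro: arg_cong[where f = "measure_pmf.prob p"])
    also have "\<dots> = 1 - measure_pmf.prob p {Y. v \<in> Y}"
      using measure_pmf.prob_compl[of "{Y. v \<in> Y}" p] by simp
    finally have sum: "(\<Sum>X\<in>{X \<in> M. v \<in> X}. \<kappa> X) =
      (1 - measure_pmf.prob p {Y. v \<in> Y}) / (1 - \<epsilon>)" .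
    show ?thesis
      unfolding sum using thin v \<open>\<epsilon> < 1\<close> by (simp add: thin_def)
  qed
  have "fractional_coloring f b G \<kappa>"
    using cover \<open>\<epsilon> < 1\<close> unfolding fractional_coloring_def M_def by (auto simp: \<kappa>_def)
  then have "fractional_chromatic_number f b G \<le> ereal (number_of_colors f b G \<kappa>)"
    unfolding fractional_chromatic_number_def by (intro INF_lower) simp
  also have "number_of_colors f b G \<kappa> \<le> (\<Sum>X\<in>M. pmf q X / (1 - \<epsilon>))"
    unfolding number_of_colors_def M_def by (intro sum_mono) (simp add: \<kappa>_def)
  also have "\<dots> = 1 / (1 - \<epsilon>)"
    using sum_pmf_eq_1[OF finM qM] by (simp flip: sum_divide_distrib)
  finally show ?thesis by simp
qed

text \<open>The sets covering a single vertex already have total weight at least 1. This makes it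
  possible to normalize by the number of colors.\<close>

lemma number_of_colors_ge_1:
  fixes G :: "('a, 'b) pre_digraph"
  assumes fin: "finite (verts G)" and "verts G \<noteq> {}" and col: "fractional_coloring f b G \<kappa>"
  shows "1 \<le> number_of_colors f b G \<kappa>"
proof -
  obtain v where "v \<in> verts G" using assms(2) by auto
  then have "1 \<le> (\<Sum>X\<in>{X \<in> bounded_subsets f b G. v \<in> X}. \<kappa> X)"
    using col by (auto simp: fractional_coloring_def)
  also have "\<dots> \<le> number_of_colors f b G \<kappa>"
    unfolding number_of_colors_def using col finite_bounded_subsets[OF fin]
    by (intro sum_mono2) (auto simp: fractional_coloring_def)
  finally show ?thesis .
qed

text \<open>Sampling \<open>X\<close> with probability proportional to \<open>\<kappa> X\<close>
  catches each vertex with probability at least one over the number of colors. The complement of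
  \<open>X\<close> is then the set to delete.\<close>

lemma thin_of_fractional_coloring:
  fixes G :: "('a, 'b) pre_digraph"
  assumes fin: "finite (verts G)" and ne: "verts G \<noteq> {}"
    and col: "fractional_coloring f b G \<kappa>"
  obtains p where "set_pmf p \<subseteq> {Y. Y \<subseteq> verts G \<and> f (remove_verts G Y) \<le> b}"
    "thin (1 - 1 / number_of_colors f b G \<kappa>) G p"
proof -
  define M where "M = bounded_subsets f b G"
  define S where "S = number_of_colors f b G \<kappa>"
  have finM: "finite M" unfolding M_def using fin by (rule finite_bounded_subsets)
  have S: "S = (\<Sum>X\<in>M. \<kappa> X)" by (simp add: S_def number_of_colors_def M_def)
  have nonneg: "0 \<le> \<kappa> X" if "X \<in> M" for X
    using col that by (auto simp: fractional_coloring_def M_def)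
  have cover: "1 \<le> (\<Sum>X\<in>{X \<in> M. v \<in> X}. \<kappa> X)" if "v \<in> verts G" for v
    using col that by (auto simp: fractional_coloring_def M_def)
  have S1: "1 \<le> S"
    unfolding S_def using assms by (rule number_of_colors_ge_1)
  have "(\<Sum>X\<in>M. \<kappa> X / S) = 1"
    using S1 by (simp add: S[symmetric] flip: sum_divide_distrib)
  then obtain q where qM: "set_pmf q \<subseteq> M" and q: "\<And>X. X \<in> M \<Longrightarrow> pmf q X = \<kappa> X / S"
    using pmf_of_finite_weights[OF finM, of "\<lambda>X. \<kappa> X / S"] nonneg S1 by auto
  define p where "p = map_pmf (\<lambda>X. verts G - X) q"
  have supp: "set_pmf p \<subseteq> {Y. Y \<subseteq> verts G \<and> f (remove_verts G Y) \<le> b}"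
    using qM unfolding p_def M_def bounded_subsets_def remove_verts_def
    by (auto simp: double_diff)
  have "measure_pmf.prob p {Y. v \<in> Y} \<le> 1 - 1 / S" if v: "v \<in> verts G" for v
  proof -
    have "1 / S \<le> (\<Sum>X\<in>{X \<in> M. v \<in> X}. \<kappa> X) / S"
      using cover[OF v] S1 by (intro divide_right_mono) auto
    also have "\<dots> = (\<Sum>X\<in>{X \<in> M. v \<in> X}. pmf q X)"
      unfolding sum_divide_distrib by (intro sum.cong) (auto simp: q)
    also have "\<dots> = measure_pmf.prob q {X \<in> M. v \<in> X}"
      using finM by (simp add: measure_measure_pmf_finite)
    also have "\<dots> \<le> measure_pmf.prob q {X. v \<in> X}"
      by (intro measure_pmf.finite_measure_mono) auto
    also have "\<dots> = 1 - measure_pmf.prob q (UNIV - {X. v \<in> X})"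
      using measure_pmf.prob_compl[of "{X. v \<in> X}" q] by simp
    also have "measure_pmf.prob q (UNIV - {X. v \<in> X}) = measure_pmf.prob p {Y. v \<in> Y}"
      using v unfolding p_def by (auto intro: arg_cong[where f = "measure_pmf.prob q"])
    finally show ?thesis by simp
  qed
  with supp have "thin (1 - 1 / S) G p" unfolding thin_def by auto
  with supp that show thesis unfolding S_def by blast
qed

theorem lemma1:
  fixes r r' :: "nat \<Rightarrow> real"
    and f :: "('a, 'b) pre_digraph \<Rightarrow> real"
    and \<G> :: "('a, 'b) pre_digraph set"
  assumes "\<And>a. 0 \<le> r a"
    and "mono r"
    and "\<And>a. r' a = r (a + 1)"
    and "graph_parameter f"
    and "\<And>E. graph E \<Longrightarrow> verts E = {} \<Longrightarrow> f E \<le> r 1"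
    and "\<And>G. G \<in> \<G> \<Longrightarrow> graph G"
  shows "fractionally_fragile f r \<G> \<longleftrightarrow> fractionally_colorable f 1 r' \<G>"
proof
  assume frag: "fractionally_fragile f r \<G>"
  show "fractionally_colorable f 1 r' \<G>"
    unfolding fractionally_colorable_def
  proof (intro allI impI ballI)
    fix a :: nat and G assume a: "1 \<le> a" and G: "G \<in> \<G>"
    interpret graph G using assms(6)[OF G] .
    obtain p where p: "set_pmf p \<subseteq> {Y. Y \<subseteq> verts G \<and> f (remove_verts G Y) \<le> r (a + 1)}"
      "thin (1 / real (a + 1)) G p"
      using frag G unfolding fractionally_fragile_def fractionally_fragile_graph_def
      by (meson le_add2)
    \<comment> \<open>Fragility is used at \<open>a + 1\<close>: for
      \<open>\<epsilon> = 1 / (a + 1)\<close> the bound \<open>1 / (1 - \<epsilon>)\<close> is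
      exactly \<open>1 + 1 / a\<close>, whence the shift in \<open>r'\<close>.\<close>
    have "fractional_chromatic_number f (r (a + 1)) G \<le> ereal (1 / (1 - 1 / real (a + 1)))"
      using a by (intro fractional_chromatic_number_le_of_thin[OF _ _ p]) auto
    also have "1 / (1 - 1 / real (a + 1)) = 1 + 1 / real a"
      using a by (simp add: field_simps)
    finally show "fractional_chromatic_number f (r' a) G \<le> ereal (1 + 1 / real a)"
      by (simp add: assms(3))
  qed
next
  assume colorable: "fractionally_colorable f 1 r' \<G>"
  show "fractionally_fragile f r \<G>"
    unfolding fractionally_fragile_def fractionally_fragile_graph_def
  proof (intro allI impI ballI)
    fix G and a :: nat assume G: "G \<in> \<G>" and a: "1 \<le> a"
    interpret graph G using assms(6)[OF G] .
    show "\<exists>p. set_pmf p \<subseteq> {Y. Y \<subseteq> verts G \<and> f (remove_verts G Y) \<le> r a} \<and>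
      thin (1 / real a) G p"
    \<comment> \<open>For \<open>a = 1\<close> thinness is vacuous. A graph without vertices is
      treated here too, since its number of colors may be 0 and could not be used for
      normalization.\<close>
    proof (cases "a = 1 \<or> verts G = {}")
      case True
      have "f (G \<restriction> {}) \<le> r 1"
        by (intro assms(5) graph_induce_empty) simp
      also have "\<dots> \<le> r a" using \<open>mono r\<close> a by (rule monoD)
      finally have "f (remove_verts G (verts G)) \<le> r a" by (simp add: remove_verts_def)
      moreover have "thin (1 / real a) G (return_pmf (verts G))"
        using True unfolding thin_def by auto
      ultimately show ?thesis by (intro exI[of _ "return_pmf (verts G)"]) simp
    next
      case False
      \<comment> \<open>Colorability is used at \<open>a - 1\<close>, which is positive here and
        satisfies \<open>r' (a - 1) = r a\<close>.\<close>
      define b where "b = a - 1"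
      have b: "1 \<le> b" "a = b + 1" using False a by (auto simp: b_def)
      have le: "fractional_chromatic_number f (r a) G \<le> ereal (1 + 1 / real b)"
        using colorable G b unfolding fractionally_colorable_def by (simp add: assms(3))
      then have "fractional_chromatic_number f (r a) G < \<infinity>"
        by (rule le_less_trans) simp
      \<comment> \<open>An optimal coloring has at most \<open>1 + 1 / b\<close> colors with no
        slack, so the thinness bound comes out as exactly \<open>1 / a\<close>.\<close>
      then obtain \<kappa> where \<kappa>: "fractional_coloring f (r a) G \<kappa>"
        "ereal (number_of_colors f (r a) G \<kappa>) = fractional_chromatic_number f (r a) G"
        by (rule fractional_chromatic_number_attained)
      define S where "S = number_of_colors f (r a) G \<kappa>"
      obtain p where p: "set_pmf p \<subseteq> {Y. Y \<subseteq> verts G \<and> f (remove_verts G Y) \<le> r a}"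
        "thin (1 - 1 / S) G p"
        unfolding S_def using thin_of_fractional_coloring[OF finite_verts _ \<kappa>(1)] False by metis
      have S: "S \<le> 1 + 1 / real b" using le by (simp add: S_def flip: \<kappa>(2))
      have "1 \<le> S"
        unfolding S_def using False by (intro number_of_colors_ge_1 \<kappa>(1)) auto
      then have "1 / (1 + 1 / real b) \<le> 1 / S"
        using S by (intro divide_left_mono) (auto intro!: mult_pos_pos add_pos_nonneg)
      moreover have "1 / (1 + 1 / real b) = 1 - 1 / real a"
        using b by (simp add: field_simps)
      ultimately have "1 - 1 / S \<le> 1 / real a" by simp
      then have "thin (1 / real a) G p" using p(2) unfolding thin_def by force
      with p(1) show ?thesis by blast
    qed
  qed
qed

end
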